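(* For each nonzero $3$-adic integer $\lambda \in \mathbb{Z}_3$ and each real $X \ge 2$, $$\tilde{N}_\lambda(X) := \#\{ n\in\mathbb{Z} : 1 \le n \le X \text{ and the 3-adic expansion } (\lambda 2^n)_3 \text{ omits the digit } 2\} \le 2 X^{\alpha_0},$$ where $\alpha_0 = \log_3 2 \approx 0.63092$.
   Context: Every $3$-adic integer has a unique expansion $\lambda=\sum_{j=0}^\infty d_j 3^j$ with $d_j\in\{0,1,2\}$, denoted $(\lambda)_3 = (\cdots d_2 d_1 d_0)_3$; it "omits the digit 2" if every $d_j\in\{0,1\}$. *)

theory Defs
  imports Complex_Main
begin

text \<open>
  The ring of 3-adic integers as the inverse limit of the rings of integers modulo \<open>3 ^ k\<close>.
  An element is a compatible family of residues, with \<open>f k\<close> the representative modulo \<open>3 ^ k\<close>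
  in the range from \<open>0\<close> to \<open>3 ^ k - 1\<close>; the condition below forces both
  the compatibility and the range.
\<close>

typedef three_adic_int = "{f :: nat \<Rightarrow> int. \<forall>k. f (Suc k) mod 3 ^ k = f k}"
  morphisms residue Abs_three_adic_int
  by (rule exI[of _ "\<lambda>_. 0"]) simp

setup_lifting type_definition_three_adic_int

lemma residue_Suc_mod: "residue x (Suc k) mod 3 ^ k = residue x k"
  using residue[of x] by simp

lemma residue_mod_self [simp]: "residue x k mod 3 ^ k = residue x k"
  by (metis mod_mod_trivial residue_Suc_mod)

lemma residue_mod: "k \<le> m \<Longrightarrow> residue x m mod 3 ^ k = residue x k"
proof (induction m rule: dec_induct)
  case base
  show ?case by simp
next
  case (step m)
  have "(3 :: int) ^ k dvd 3 ^ m"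
    using step.hyps by (simp add: le_imp_power_dvd)
  then have "residue x (Suc m) mod 3 ^ k = (residue x (Suc m) mod 3 ^ m) mod 3 ^ k"
    by (simp add: mod_mod_cancel)
  then show ?case
    using step.IH by (simp add: residue_Suc_mod)
qed

lemma three_adic_int_eqI: "(\<And>k. residue x k = residue y k) \<Longrightarrow> x = y"
  by (metis ext residue_inject)

lemma mod_pow_Suc [simp]: "(a :: int) mod (3 * 3 ^ k) mod 3 ^ k = a mod 3 ^ k"
  by (simp add: mod_mod_cancel)

instantiation three_adic_int :: comm_ring_1
begin

lift_definition zero_three_adic_int :: three_adic_int is "\<lambda>k. 0 mod 3 ^ k"
  by simp

lift_definition one_three_adic_int :: three_adic_int is "\<lambda>k. 1 mod 3 ^ k"
  by simp

lift_definition plus_three_adic_int :: "three_adic_int \<Rightarrow> three_adic_int \<Rightarrow> three_adic_int"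
  is "\<lambda>f g k. (f k + g k) mod 3 ^ k"
  by simp (metis mod_add_eq)

lift_definition minus_three_adic_int :: "three_adic_int \<Rightarrow> three_adic_int \<Rightarrow> three_adic_int"
  is "\<lambda>f g k. (f k - g k) mod 3 ^ k"
  by simp (metis mod_diff_eq)

lift_definition uminus_three_adic_int :: "three_adic_int \<Rightarrow> three_adic_int"
  is "\<lambda>f k. (- f k) mod 3 ^ k"
  by simp (metis mod_minus_eq)

lift_definition times_three_adic_int :: "three_adic_int \<Rightarrow> three_adic_int \<Rightarrow> three_adic_int"
  is "\<lambda>f g k. (f k * g k) mod 3 ^ k"
  by simp (metis mod_mult_eq)

lemmas residue_ring_ops =
  zero_three_adic_int.rep_eq one_three_adic_int.rep_eq plus_three_adic_int.rep_eq
  minus_three_adic_int.rep_eq uminus_three_adic_int.rep_eq times_three_adic_int.rep_eq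

instance
proof
  fix a b c :: three_adic_int
  show "a * b * c = a * (b * c)"
    by (rule three_adic_int_eqI) (simp add: residue_ring_ops mod_simps mult.assoc)
  show "a * b = b * a"
    by (rule three_adic_int_eqI) (simp add: residue_ring_ops mult.commute)
  show "1 * a = a"
    by (rule three_adic_int_eqI) (simp add: residue_ring_ops mod_simps)
  show "a + b + c = a + (b + c)"
    by (rule three_adic_int_eqI) (simp add: residue_ring_ops mod_simps add.assoc)
  show "a + b = b + a"
    by (rule three_adic_int_eqI) (simp add: residue_ring_ops add.commute)
  show "0 + a = a"
    by (rule three_adic_int_eqI) (simp add: residue_ring_ops)
  show "- a + a = 0"
    by (rule three_adic_int_eqI) (simp add: residue_ring_ops mod_simps)
  show "a - b = a + - b"
    by (rule three_adic_int_eqI) (simp add: residue_ring_ops mod_simps)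
  show "(a + b) * c = a * c + b * c"
    by (rule three_adic_int_eqI) (simp add: residue_ring_ops mod_simps distrib_right)
  have "residue 0 1 \<noteq> residue 1 1"
    by (simp add: residue_ring_ops)
  then show "(0 :: three_adic_int) \<noteq> 1"
    by metis
qed

end

text \<open>
  The 3-adic metric: distinct \<open>x\<close> and \<open>y\<close> have distance \<open>1 / 3 ^ v\<close>, where \<open>v\<close> is the 3-adic
  valuation of \<open>x - y\<close>, i.e. the largest \<open>k\<close> such that \<open>x\<close> and \<open>y\<close> agree modulo \<open>3 ^ k\<close>.
\<close>

definition agreement :: "three_adic_int \<Rightarrow> three_adic_int \<Rightarrow> nat" where
  "agreement x y = (LEAST k. residue x (Suc k) \<noteq> residue y (Suc k))"

lemma residue_0 [simp]: "residue x 0 = 0"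
  using residue_mod_self[of x 0] by (simp del: residue_mod_self)

lemma residue_eq_iff_agreement:
  assumes "x \<noteq> y"
  shows "residue x k = residue y k \<longleftrightarrow> k \<le> agreement x y"
proof -
  obtain m where "residue x m \<noteq> residue y m"
    using assms three_adic_int_eqI by blast
  then obtain j where "residue x (Suc j) \<noteq> residue y (Suc j)"
    by (cases m) auto
  then have ne: "residue x (Suc (agreement x y)) \<noteq> residue y (Suc (agreement x y))"
    unfolding agreement_def by (rule LeastI)
  show ?thesis
  proof
    assume eq: "residue x k = residue y k"
    show "k \<le> agreement x y"
    proof (rule ccontr)
      assume "\<not> k \<le> agreement x y"
      then have "Suc (agreement x y) \<le> k" by simp
      then show False using eq ne by (metis residue_mod)
    qed
  next
    assume "k \<le> agreement x y"
    then show "residue x k = residue y k"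
      by (cases k) (auto simp: agreement_def Suc_le_eq dest: not_less_Least)
  qed
qed

instantiation three_adic_int :: metric_space
begin

definition dist_three_adic_int :: "three_adic_int \<Rightarrow> three_adic_int \<Rightarrow> real" where
  "dist x y = (if x = y then 0 else 1 / 3 ^ agreement x y)"

definition uniformity_three_adic_int :: "(three_adic_int \<times> three_adic_int) filter" where
  "uniformity_three_adic_int = (INF e\<in>{0<..}. principal {(x, y). dist x y < e})"

definition open_three_adic_int :: "three_adic_int set \<Rightarrow> bool" where
  "open_three_adic_int U \<longleftrightarrow> (\<forall>x\<in>U. eventually (\<lambda>(x', y). x' = x \<longrightarrow> y \<in> U) uniformity)"

instance
proof
  fix x y z :: three_adic_int
  show "dist x y = 0 \<longleftrightarrow> x = y"
    by (simp add: dist_three_adic_int_def)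
  show "dist x y \<le> dist x z + dist y z"
  proof (cases "x = y \<or> x = z \<or> y = z")
    case True
    then show ?thesis
      by (auto simp: dist_three_adic_int_def agreement_def eq_commute)
  next
    case False
    let ?m = "min (agreement x z) (agreement y z)"
    have "residue x ?m = residue y ?m"
      using False residue_eq_iff_agreement[of x z ?m] residue_eq_iff_agreement[of y z ?m] by simp
    then have "?m \<le> agreement x y"
      using False by (simp add: residue_eq_iff_agreement)
    then have "(1 :: real) / 3 ^ agreement x y \<le> 1 / 3 ^ ?m"
      by (simp add: frac_le power_increasing)
    also have "\<dots> \<le> 1 / 3 ^ agreement x z + 1 / 3 ^ agreement y z"
      by (simp add: min_def)
    finally show ?thesis
      using False by (simp add: dist_three_adic_int_def)
  qed
qed (simp_all add: uniformity_three_adic_int_def open_three_adic_int_def)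

end

definition is_ternary_expansion :: "(nat \<Rightarrow> nat) \<Rightarrow> three_adic_int \<Rightarrow> bool" where
  "is_ternary_expansion d x \<longleftrightarrow>
     (\<forall>j. d j \<in> {0, 1, 2}) \<and> (\<lambda>j. of_nat (d j) * 3 ^ j) sums x"

definition ternary_digits :: "three_adic_int \<Rightarrow> nat \<Rightarrow> nat" where
  "ternary_digits x = (THE d. is_ternary_expansion d x)"

definition omits_digit_two :: "three_adic_int \<Rightarrow> bool" where
  "omits_digit_two x \<longleftrightarrow> (\<forall>j. ternary_digits x j \<in> {0, 1})"

lemma residue_of_nat: "residue (of_nat n) k = int n mod 3 ^ k"
  by (induction n) (simp_all add: residue_ring_ops mod_simps)

lemma dist_lt_iff: "dist x y < 1 / 3 ^ k \<longleftrightarrow> residue x (Suc k) = residue y (Suc k)"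
proof (cases "x = y")
  case False
  then show ?thesis
    by (simp add: dist_three_adic_int_def residue_eq_iff_agreement divide_simps Suc_le_eq)
qed (simp add: dist_three_adic_int_def)

lemma tendsto_three_adic_iff:
  "f \<longlonglongrightarrow> (x :: three_adic_int) \<longleftrightarrow>
     (\<forall>k. eventually (\<lambda>n. residue (f n) k = residue x k) sequentially)"
proof
  assume f: "f \<longlonglongrightarrow> x"
  show "\<forall>k. eventually (\<lambda>n. residue (f n) k = residue x k) sequentially"
  proof
    fix k
    have "eventually (\<lambda>n. dist (f n) x < 1 / 3 ^ k) sequentially"
      using f by (rule tendstoD) simp
    then show "eventually (\<lambda>n. residue (f n) k = residue x k) sequentially"
      by (rule eventually_mono) (metis dist_lt_iff residue_Suc_mod)
  qed
next
  assume f: "\<forall>k. eventually (\<lambda>n. residue (f n) k = residue x k) sequentially"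
  show "f \<longlonglongrightarrow> x"
  proof (rule tendstoI)
    fix e :: real
    assume "0 < e"
    then obtain k where k: "(1 / 3) ^ k < e"
      using real_arch_pow_inv[of e "1 / 3"] by auto
    have "eventually (\<lambda>n. residue (f n) (Suc k) = residue x (Suc k)) sequentially"
      using f by blast
    then show "eventually (\<lambda>n. dist (f n) x < e) sequentially"
    proof (rule eventually_mono)
      fix n
      assume "residue (f n) (Suc k) = residue x (Suc k)"
      then have "dist (f n) x < 1 / 3 ^ k"
        by (simp only: dist_lt_iff)
      also have "\<dots> < e"
        using k by (simp add: power_one_over)
      finally show "dist (f n) x < e" .
    qed
  qed
qed

lemma ternary_sums_iff:
  fixes d :: "nat \<Rightarrow> nat"
  shows "(\<lambda>j. of_nat (d j) * 3 ^ j) sums (x :: three_adic_int) \<longleftrightarrow>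
    (\<forall>k. residue x k = int (\<Sum>j<k. d j * 3 ^ j) mod 3 ^ k)"
proof -
  have partial: "(\<Sum>j<n. of_nat (d j) * 3 ^ j) = (of_nat (\<Sum>j<n. d j * 3 ^ j) :: three_adic_int)"
    for n by simp
  have const: "int (\<Sum>j<n. d j * 3 ^ j) mod 3 ^ k = int (\<Sum>j<k. d j * 3 ^ j) mod 3 ^ k"
    if "k \<le> n" for n k
    using that
  proof (induction n rule: dec_induct)
    case (step n)
    have "(3 :: int) ^ k dvd int (d n) * 3 ^ n"
      using step.hyps by (simp add: le_imp_power_dvd)
    then have "(int (\<Sum>j<n. d j * 3 ^ j) + int (d n) * 3 ^ n) mod 3 ^ k
        = int (\<Sum>j<n. d j * 3 ^ j) mod 3 ^ k"
      by (metis add.right_neutral dvd_imp_mod_0 mod_add_right_eq)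
    then show ?case using step.IH by simp
  qed simp
  have "eventually (\<lambda>n. residue (of_nat (\<Sum>j<n. d j * 3 ^ j)) k = residue x k) sequentially
      \<longleftrightarrow> residue x k = int (\<Sum>j<k. d j * 3 ^ j) mod 3 ^ k" for k
  proof -
    have "eventually (\<lambda>n. residue (of_nat (\<Sum>j<n. d j * 3 ^ j)) k
        = int (\<Sum>j<k. d j * 3 ^ j) mod 3 ^ k) sequentially"
      unfolding eventually_sequentially residue_of_nat using const by blast
    then have "eventually (\<lambda>n. residue (of_nat (\<Sum>j<n. d j * 3 ^ j)) k = residue x k) sequentially
      \<longleftrightarrow> eventually (\<lambda>n::nat. residue x k = int (\<Sum>j<k. d j * 3 ^ j) mod 3 ^ k) sequentially"
      by (rule eventually_subst[OF eventually_mono]) metis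
    then show ?thesis by simp
  qed
  then show ?thesis
    unfolding sums_def tendsto_three_adic_iff partial by simp
qed

lemma ternary_partial_sum_less:
  assumes "\<And>j. d j \<in> {0, 1, 2 :: nat}"
  shows "(\<Sum>j<k. d j * 3 ^ j) < (3 :: nat) ^ k"
proof (induction k)
  case (Suc k)
  have "d k * 3 ^ k \<le> 2 * 3 ^ k"
    using assms[of k] by (intro mult_right_mono) auto
  then have "(\<Sum>j<k. d j * 3 ^ j) + d k * 3 ^ k < 3 ^ k + 2 * 3 ^ k"
    by (rule add_less_le_mono[OF Suc])
  then show ?case by simp
qed simp

lemma is_ternary_expansion_iff:
  "is_ternary_expansion d x \<longleftrightarrow>
     (\<forall>j. d j \<in> {0, 1, 2}) \<and> (\<forall>k. residue x k = int (\<Sum>j<k. d j * 3 ^ j))"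
proof -
  have "int (\<Sum>j<k. d j * 3 ^ j) mod 3 ^ k = int (\<Sum>j<k. d j * 3 ^ j)"
    if "\<forall>j. d j \<in> {0, 1, 2}" for k
  proof (rule mod_pos_pos_trivial)
    have "(\<Sum>j<k. d j * 3 ^ j) < 3 ^ k"
      using that ternary_partial_sum_less by blast
    then show "int (\<Sum>j<k. d j * 3 ^ j) < 3 ^ k"
      by (metis of_nat_less_iff of_nat_numeral of_nat_power)
  qed (rule of_nat_0_le_iff)
  then show ?thesis
    unfolding is_ternary_expansion_def ternary_sums_iff by metis
qed

lemma residue_nonneg: "0 \<le> residue x k"
  by (metis residue_mod_self pos_mod_sign zero_less_numeral zero_less_power)

lemma residue_less: "residue x k < 3 ^ k"
  by (metis residue_mod_self pos_mod_bound zero_less_numeral zero_less_power)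

lemma is_ternary_expansion_explicit:
  "is_ternary_expansion (\<lambda>j. nat (residue x (Suc j) div 3 ^ j)) x"
  unfolding is_ternary_expansion_iff
proof (intro conjI allI)
  fix j
  have "residue x (Suc j) div 3 ^ j * 3 ^ j \<le> residue x (Suc j)"
    by (simp add: residue_nonneg minus_mod_eq_div_mult [symmetric])
  also have "\<dots> < 3 * 3 ^ j"
    using residue_less[of x "Suc j"] by simp
  finally have "residue x (Suc j) div 3 ^ j < 3"
    by simp
  then show "nat (residue x (Suc j) div 3 ^ j) \<in> {0, 1, 2}"
    by auto
next
  fix k
  show "residue x k = int (\<Sum>j<k. nat (residue x (Suc j) div 3 ^ j) * 3 ^ j)"
  proof (induction k)
    case (Suc k)
    have "0 \<le> residue x (Suc k) div 3 ^ k"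
      by (simp add: residue_nonneg pos_imp_zdiv_nonneg_iff)
    moreover have "residue x (Suc k) = residue x (Suc k) div 3 ^ k * 3 ^ k + residue x k"
      by (metis residue_Suc_mod div_mult_mod_eq)
    ultimately show ?case using Suc by simp
  qed simp
qed

lemma is_ternary_expansion_unique:
  assumes "is_ternary_expansion d x" "is_ternary_expansion e x"
  shows "d = e"
proof
  fix j
  have "int (\<Sum>i<k. d i * 3 ^ i) = int (\<Sum>i<k. e i * 3 ^ i)" for k
    using assms unfolding is_ternary_expansion_iff by metis
  from this[of j] this[of "Suc j"] show "d j = e j"
    by simp
qed

lemma ex1_ternary_expansion: "\<exists>!d. is_ternary_expansion d x"
  using is_ternary_expansion_explicit is_ternary_expansion_unique by blast

lemma is_ternary_expansion_ternary_digits: "is_ternary_expansion (ternary_digits x) x"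
  unfolding ternary_digits_def by (rule theI'[OF ex1_ternary_expansion])

lemma ternary_digits_eq: "ternary_digits x j = nat (residue x (Suc j) div 3 ^ j)"
  using is_ternary_expansion_unique[OF is_ternary_expansion_ternary_digits
      is_ternary_expansion_explicit] by metis

definition omit_count :: "three_adic_int \<Rightarrow> real \<Rightarrow> nat" where
  "omit_count x X = card {n :: int. 1 \<le> n \<and> of_int n \<le> X \<and> omits_digit_two (x * 2 ^ nat n)}"

end

theory Submission
  imports Defs "HOL-Number_Theory.Residue_Primitive_Roots"
begin

text \<open>
  Write \<open>\<lambda> = 3 ^ v * u\<close> with \<open>u\<close> a unit. If \<open>\<lambda> * 2 ^ n\<close> omits the digit 2, its lowest \<open>v\<close> digits
  are 0 and the next one is 1, so the \<open>k\<close> digits that follow leave at most \<open>2 ^ k\<close> residues modulo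
  \<open>3 ^ (v + k + 1)\<close>. As 2 is a primitive root modulo \<open>3 ^ (k + 1)\<close>, these residues are distinct for
  distinct \<open>n < 2 * 3 ^ k\<close>, so at most \<open>2 ^ k\<close> such \<open>n\<close> exist. Choosing \<open>k\<close> with
  \<open>2 * 3 ^ (k - 1) \<le> X < 2 * 3 ^ k\<close> gives the bound.
\<close>

text \<open>A primitive root modulo an odd prime \<open>p\<close> is one modulo every power of
  \<open>p\<close> iff its power \<open>p - 1\<close> is not 1 modulo \<open>p^2\<close>. Here
  \<open>2^2 = 4\<close> is not 1 modulo 9.\<close>

lemma residue_primroot_three_power_two: "residue_primroot (3 ^ Suc k) 2"
proof -
  have "ord 3 (2 :: nat) dvd 2"
    by (subst ord_divides [symmetric]) (simp add: cong_def)
  moreover have "ord 3 (2 :: nat) \<noteq> 1"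
    using ord_divides[of 2 1 3] by (auto simp: cong_def)
  ultimately have "ord 3 (2 :: nat) = 2"
    using two_is_prime_nat prime_nat_iff by blast
  moreover have "coprime (3 :: nat) 2"
    by (simp add: coprime_commute)
  ultimately have "residue_primroot 3 2"
    by (simp add: residue_primroot_def totient_prime)
  then have "\<forall>k>0. residue_primroot (3 ^ k) 2"
    by (subst residue_primroot_prime_lift_iff) (auto simp: cong_def)
  then show ?thesis
    by blast
qed

lemma two_power_cong_three_power_iff:
  "[2 ^ m = (2 :: nat) ^ n] (mod 3 ^ Suc k) \<longleftrightarrow> [m = n] (mod 2 * 3 ^ k)"
proof -
  have "ord (3 ^ Suc k) (2 :: nat) = 2 * 3 ^ k" and "coprime (3 ^ Suc k) (2 :: nat)"
    using residue_primroot_three_power_two[of k] totient_prime_power_Suc[of 3 k]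
    by (auto simp: residue_primroot_def)
  then show ?thesis
    using order_divides_expdiff by metis
qed

lemma residue_times_two_power: "residue (x * 2 ^ n) k = residue x k * 2 ^ n mod 3 ^ k"
  using residue_of_nat[of "2 ^ n" k] by (simp add: residue_ring_ops mod_simps)

lemma residue_ternary_digits: "residue x k = int (\<Sum>j<k. ternary_digits x j * 3 ^ j)"
  using is_ternary_expansion_ternary_digits[of x] unfolding is_ternary_expansion_iff by blast

text \<open>Thus \<open>agreement x 0\<close> serves as the 3-adic valuation of a nonzero
  \<open>x\<close>.\<close>

lemma residue_eq_0_iff_agreement: "x \<noteq> 0 \<Longrightarrow> residue x k = 0 \<longleftrightarrow> k \<le> agreement x 0"
  using residue_eq_iff_agreement[of x 0 k] by (simp add: residue_ring_ops)

lemma residue_times_two_power_eq_0_iff: "residue (x * 2 ^ n) k = 0 \<longleftrightarrow> residue x k = 0"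
proof
  assume "residue (x * 2 ^ n) k = 0"
  then have "3 ^ k dvd residue x k * 2 ^ n"
    by (simp add: residue_times_two_power mod_0_imp_dvd)
  moreover have "coprime (3 ^ k :: int) (2 ^ n)"
    by simp
  ultimately have "3 ^ k dvd residue x k"
    by (simp add: coprime_dvd_mult_left_iff)
  then show "residue x k = 0"
    by (metis dvd_imp_mod_0 residue_mod_self)
qed (simp add: residue_times_two_power)

lemma agreement_times_two_power:
  assumes "x \<noteq> 0"
  shows "x * 2 ^ n \<noteq> 0" and "agreement (x * 2 ^ n) 0 = agreement x 0"
proof -
  show nz: "x * 2 ^ n \<noteq> 0"
    using residue_times_two_power_eq_0_iff[of x n "Suc (agreement x 0)"]
      residue_eq_0_iff_agreement[OF assms] by (auto simp: zero_three_adic_int.rep_eq)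
  show "agreement (x * 2 ^ n) 0 = agreement x 0"
    using residue_times_two_power_eq_0_iff[of x n] residue_eq_0_iff_agreement[OF assms]
      residue_eq_0_iff_agreement[OF nz] by (metis dual_order.refl order_antisym)
qed

text \<open>Cancelling the factor \<open>3 ^ agreement x 0\<close> leaves a congruence modulo
  \<open>3 ^ Suc k\<close> with a cofactor prime to 3. Cancelling that too compares the powers of 2
  alone.\<close>

lemma residue_two_power_eq_imp_cong:
  assumes "x \<noteq> 0"
    and eq: "residue (x * 2 ^ m) (agreement x 0 + Suc k) = residue (x * 2 ^ n) (agreement x 0 + Suc k)"
  shows "[m = n] (mod 2 * 3 ^ k)"
proof -
  define v where "v = agreement x 0"
  define r where "r = residue x (v + Suc k)"
  \<comment> \<open>The integer \<open>r\<close> has exactly \<open>v\<close> factors 3, so its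
    cofactor \<open>w\<close> represents the unit part of \<open>x\<close>.\<close>
  have "r mod 3 ^ v = 0" "r mod 3 ^ Suc v \<noteq> 0"
    using residue_eq_0_iff_agreement[OF assms(1)] residue_mod[of v "v + Suc k" x]
      residue_mod[of "Suc v" "v + Suc k" x]
    unfolding r_def v_def by (auto simp del: power_Suc)
  then obtain w where w: "r = 3 ^ v * w"
    by (auto dest: mod_0_imp_dvd)
  with \<open>r mod 3 ^ Suc v \<noteq> 0\<close> have "\<not> 3 dvd w"
    by (auto simp: power_Suc2 simp del: power_Suc)
  then have coprime: "coprime (3 ^ Suc k) w"
    using prime_imp_coprime[of "3 :: int" w] by simp
  have "r * 2 ^ m mod 3 ^ (v + Suc k) = r * 2 ^ n mod 3 ^ (v + Suc k)"
    using eq unfolding residue_times_two_power r_def v_def .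
  then have "3 ^ (v + Suc k) dvd r * 2 ^ m - r * 2 ^ n"
    by (simp only: mod_eq_dvd_iff)
  also have "r * 2 ^ m - r * 2 ^ n = 3 ^ v * (w * (2 ^ m - 2 ^ n))"
    by (simp add: w algebra_simps)
  finally have "3 ^ Suc k dvd w * (2 ^ m - 2 ^ n)"
    by (simp add: power_add)
  then have "3 ^ Suc k dvd (2 ^ m - 2 ^ n :: int)"
    using coprime coprime_dvd_mult_right_iff by blast
  then have "[int (2 ^ m) = int (2 ^ n)] (mod int (3 ^ Suc k))"
    by (simp add: cong_iff_dvd_diff)
  then show ?thesis
    using two_power_cong_three_power_iff cong_int_iff by blast
qed

text \<open>A vanishing residue is a vanishing sum of natural numbers, so each digit in it is 0. The
  digit at the valuation is the first nonzero one, hence 1 once 2 is excluded.\<close>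

lemma omits_digit_two_lowest_digits:
  assumes "x \<noteq> 0" "omits_digit_two x"
  shows "j < agreement x 0 \<Longrightarrow> ternary_digits x j = 0"
    and "ternary_digits x (agreement x 0) = 1"
proof -
  define v where "v = agreement x 0"
  have "residue x v = 0" "residue x (Suc v) \<noteq> 0"
    using residue_eq_0_iff_agreement[OF assms(1)] by (simp_all add: v_def)
  then have zero: "(\<Sum>j<v. ternary_digits x j * 3 ^ j) = 0"
    and nz: "(\<Sum>j<Suc v. ternary_digits x j * 3 ^ j) \<noteq> 0"
    by (metis of_nat_eq_0_iff residue_ternary_digits)+
  show "j < agreement x 0 \<Longrightarrow> ternary_digits x j = 0"
    using zero by (simp add: v_def)
  have "ternary_digits x v \<noteq> 0"
    using zero nz by auto
  then show "ternary_digits x (agreement x 0) = 1"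
    using assms(2) unfolding omits_digit_two_def v_def by (metis insertE singletonD)
qed

lemma card_omits_digit_two_le:
  assumes "x \<noteq> 0"
  shows "card {n. n < 2 * 3 ^ k \<and> omits_digit_two (x * 2 ^ n)} \<le> 2 ^ k"
proof -
  define v where "v = agreement x 0"
  \<comment> \<open>The only digits still free are the \<open>k\<close> above position
    \<open>v\<close>; \<open>f n\<close> records which of them are 1.\<close>
  define f where "f n = {j \<in> {v<..v + k}. ternary_digits (x * 2 ^ n) j = 1}" for n :: nat
  let ?S = "{n. n < 2 * 3 ^ k \<and> omits_digit_two (x * 2 ^ n)}"
  have "inj_on f ?S"
  proof (rule inj_onI)
    fix m n
    assume m: "m \<in> ?S" and n: "n \<in> ?S" and eq: "f m = f n"
    \<comment> \<open>Multiplying by a power of 2 keeps the valuation, so both products have the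
      same forced digits up to \<open>v\<close>; above \<open>v\<close> the set \<open>f\<close>
      fixes them.\<close>
    have "ternary_digits (x * 2 ^ m) j = ternary_digits (x * 2 ^ n) j" if "j < v + Suc k" for j
    proof (cases j v rule: linorder_cases)
      case greater
      with that have j: "j \<in> {v<..v + k}"
        by simp
      have "ternary_digits (x * 2 ^ m) j = 1 \<longleftrightarrow> ternary_digits (x * 2 ^ n) j = 1"
        using eq j unfolding f_def by blast
      then show ?thesis
        using m n unfolding omits_digit_two_def by (metis (lifting) insertE mem_Collect_eq singletonD)
    next
      case equal
      then show ?thesis
        using m n omits_digit_two_lowest_digits(2) agreement_times_two_power[OF assms] v_def
        by (metis (mono_tags, lifting) mem_Collect_eq)
    qed (use m n omits_digit_two_lowest_digits(1) agreement_times_two_power[OF assms]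
        in \<open>simp add: v_def\<close>)
    then have "residue (x * 2 ^ m) (v + Suc k) = residue (x * 2 ^ n) (v + Suc k)"
      unfolding residue_ternary_digits by simp
    then have "[m = n] (mod 2 * 3 ^ k)"
      unfolding v_def by (rule residue_two_power_eq_imp_cong[OF assms])
    then show "m = n"
      using m n by (simp add: cong_less_modulus_unique_nat)
  qed
  moreover have "f ` ?S \<subseteq> Pow {v<..v + k}"
    by (auto simp: f_def)
  ultimately have "card ?S \<le> card (Pow {v<..v + k})"
    by (rule card_inj_on_le) simp
  then show ?thesis
    by (simp add: card_Pow)
qed

lemma omit_count_le:
  assumes "x \<noteq> 0" "X < 2 * 3 ^ k"
  shows "omit_count x X \<le> 2 ^ k"
proof -
  let ?S = "{n. n < 2 * 3 ^ k \<and> omits_digit_two (x * 2 ^ n)}"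
  have "{n :: int. 1 \<le> n \<and> of_int n \<le> X \<and> omits_digit_two (x * 2 ^ nat n)} \<subseteq> int ` ?S"
  proof
    fix n :: int
    assume n: "n \<in> {n. 1 \<le> n \<and> of_int n \<le> X \<and> omits_digit_two (x * 2 ^ nat n)}"
    then have "real (nat n) < real (2 * 3 ^ k)"
      using assms(2) by simp
    then have "nat n < 2 * 3 ^ k"
      by (simp only: of_nat_less_iff)
    with n show "n \<in> int ` ?S"
      by (intro image_eqI[of _ _ "nat n"]) auto
  qed
  then have "omit_count x X \<le> card (int ` ?S)"
    unfolding omit_count_def by (intro card_mono) auto
  also have "\<dots> = card ?S"
    by (simp add: card_image)
  also have "\<dots> \<le> 2 ^ k"
    by (rule card_omits_digit_two_le[OF assms(1)])
  finally show ?thesis .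
qed

theorem theorem1p4:
  fixes lam :: three_adic_int and X :: real
  assumes "lam \<noteq> 0" and "X \<ge> 2"
  shows "real (omit_count lam X) \<le> 2 * X powr log 3 2"
proof -
  \<comment> \<open>Bracketing by powers of 3 is done on natural numbers, hence the floor;
    \<open>X \<ge> 2\<close> makes it positive.\<close>
  have "1 \<le> nat \<lfloor>X / 2\<rfloor>"
    using assms(2) by linarith
  then obtain k where "3 ^ k \<le> nat \<lfloor>X / 2\<rfloor>" "nat \<lfloor>X / 2\<rfloor> < 3 ^ (k + 1)"
    using ex_power_ivl1[of 3 "nat \<lfloor>X / 2\<rfloor>"] by force
  moreover have "real a \<le> X / 2 \<and> X / 2 < real b"
    if "a \<le> nat \<lfloor>X / 2\<rfloor>" "nat \<lfloor>X / 2\<rfloor> < b" for a b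
    using that assms(2) by linarith
  ultimately have lower: "real (3 ^ k) \<le> X / 2" and upper: "X / 2 < real (3 ^ (k + 1))"
    by blast+
  \<comment> \<open>This \<open>k\<close> is one less than the exponent in the overview:
    \<open>X < 2 * 3 ^ (k + 1)\<close>. The extra factor 2 is the constant of the final
    bound.\<close>
  have "omit_count lam X \<le> 2 ^ Suc k"
    using upper by (intro omit_count_le[OF assms(1)]) simp
  then have "real (omit_count lam X) \<le> real (2 ^ Suc k)"
    by (simp only: of_nat_le_iff)
  \<comment> \<open>Writing 2 as a power of 3 turns \<open>2 ^ k\<close> into \<open>3 ^ k\<close>
    raised to \<open>log 3 2\<close>, which is monotone in the base;
    \<open>3 ^ k \<le> X / 2 \<le> X\<close> suffices.\<close>
  also have "\<dots> = 2 * (3 powr log 3 2) ^ k"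
    by simp
  also have "(3 powr log 3 2) ^ k = (3 ^ k :: real) powr log 3 2"
    by (simp add: powr_powr mult.commute flip: powr_realpow del: powr_log_cancel)
  also have "\<dots> \<le> X powr log 3 2"
    using lower assms(2) by (intro powr_mono2) auto
  finally show ?thesis
    by simp
qed

end
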